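(* For quasi-graded posets the zipping operation preserves the Eulerian property: if $(P,\rho,\bar\zeta)$ is an Eulerian quasi-graded poset with a zipper $x,y,z$, then the zipped quasi-graded poset $(Q,\rho_Q,\bar\zeta_Q)$ is Eulerian.
   Context: A quasi-graded poset $(P,\rho,\bar\zeta)$ consists of a finite poset $P$, a function $\rho:P\to\mathbb N$ with $x<y\Rightarrow\rho(x)<\rho(y)$, and a complex-valued function $\bar\zeta$ in the incidence algebra of $P$ with $\bar\zeta(x,x)=1$ for all $x$; set $\bar\zeta(u,v)=0$ if $u\not\le v$. Write $\rho(x,y)=\rho(y)-\rho(x)$. It is Eulerian if for all $x\le z$ $$\sum_{x\le y\le z}(-1)^{\rho(x,y)}\,\bar\zeta(x,y)\,\bar\zeta(y,z)=\delta_{x,z}.$$ A zipper in $(P,\rho,\bar\zeta)$ consists of three distinct elements $x,y,z$ such that (i) $\rho(x)=\rho(y)=\rho(z)+1$; (ii) $z$ is covered by $x$ and $y$ and by no other element; (iii) for all $v>z$ with $\rho(v)>\rho(x)$, $\bar\zeta(x,v)=\bar\zeta(y,v)=\bar\zeta(z,v)$; (iv) $\bar\zeta(z,x)=\bar\zeta(z,y)=1$. The zipped quasi-graded poset is $Q=(P\setminus\{x,y,z\})\cup\{w\}$ with $w$ a new element. $Q$ inherits the order of $P$ together with the relations $u<_Qw$ if $u<_Px$ or $u<_Py$, and $w<_Qv$ if $x<_Pv$ or $y<_Pv$ (and relations implied by transitivity). $\rho_Q$ is inherited from $P$ with $\rho_Q(w)=\rho(x)$. $\bar\zeta_Q$ is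 inherited from $\bar\zeta$ on pairs not involving $w$, and $\bar\zeta_Q(w,v)=\bar\zeta(x,v)$, $\bar\zeta_Q(u,w)=\bar\zeta(u,x)+\bar\zeta(u,y)-\bar\zeta(u,z)$, $\bar\zeta_Q(w,w)=1$. *)

theory Defs
  imports Complex_Main
begin

(* The order is a relation r on P, (u, v) \<in> r meaning u \<le> v; r is contained in P \<times> P by
   partial_order_on. *)

locale quasi_graded_poset =
  fixes P :: "'a set" and r :: "'a rel" and \<rho> :: "'a \<Rightarrow> nat" and \<zeta> :: "'a \<Rightarrow> 'a \<Rightarrow> complex"
  assumes finite_carrier: "finite P"
    and order: "partial_order_on P r"
    and rank_strict_mono: "(u, v) \<in> r \<Longrightarrow> u \<noteq> v \<Longrightarrow> \<rho> u < \<rho> v"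
    and zeta_diag: "u \<in> P \<Longrightarrow> \<zeta> u u = 1"
    and zeta_outside: "u \<in> P \<Longrightarrow> v \<in> P \<Longrightarrow> (u, v) \<notin> r \<Longrightarrow> \<zeta> u v = 0"

(* The subtraction of ranks on nat is never truncated, since u \<le> t in every summand. *)
locale eulerian_quasi_graded_poset = quasi_graded_poset +
  assumes eulerian: "(u, v) \<in> r \<Longrightarrow>
    (\<Sum>t | (u, t) \<in> r \<and> (t, v) \<in> r. (-1) ^ (\<rho> t - \<rho> u) * \<zeta> u t * \<zeta> t v) = (if u = v then 1 else 0)"

definition strictly_below :: "'a rel \<Rightarrow> 'a \<Rightarrow> 'a \<Rightarrow> bool" where
  "strictly_below r u v \<longleftrightarrow> (u, v) \<in> r \<and> u \<noteq> v"

definition covered_by :: "'a rel \<Rightarrow> 'a \<Rightarrow> 'a \<Rightarrow> bool" where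
  "covered_by r u v \<longleftrightarrow>
     strictly_below r u v \<and> \<not> (\<exists>t. strictly_below r u t \<and> strictly_below r t v)"

definition zipper ::
  "'a set \<Rightarrow> 'a rel \<Rightarrow> ('a \<Rightarrow> nat) \<Rightarrow> ('a \<Rightarrow> 'a \<Rightarrow> complex) \<Rightarrow> 'a \<Rightarrow> 'a \<Rightarrow> 'a \<Rightarrow> bool" where
  "zipper P r \<rho> \<zeta> x y z \<longleftrightarrow>
     x \<in> P \<and> y \<in> P \<and> z \<in> P \<and> x \<noteq> y \<and> x \<noteq> z \<and> y \<noteq> z \<and>
     \<rho> x = \<rho> y \<and> \<rho> x = \<rho> z + 1 \<and>
     {v. covered_by r z v} = {x, y} \<and>
     (\<forall>v. strictly_below r z v \<and> \<rho> v > \<rho> x \<longrightarrow> \<zeta> x v = \<zeta> y v \<and> \<zeta> y v = \<zeta> z v) \<and>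
     \<zeta> z x = 1 \<and> \<zeta> z y = 1"

(* In the zipped poset None is the new element w, and Some u is an element u of P other
   than x, y and z. *)

definition zip_carrier :: "'a set \<Rightarrow> 'a \<Rightarrow> 'a \<Rightarrow> 'a \<Rightarrow> 'a option set" where
  "zip_carrier P x y z = insert None (Some ` (P - {x, y, z}))"

inductive_set zip_less :: "'a set \<Rightarrow> 'a rel \<Rightarrow> 'a \<Rightarrow> 'a \<Rightarrow> 'a \<Rightarrow> 'a option rel"
  for P :: "'a set" and r :: "'a rel" and x y z :: 'a where
  inherited: "u \<in> P - {x, y, z} \<Longrightarrow> v \<in> P - {x, y, z} \<Longrightarrow> strictly_below r u v \<Longrightarrow>
    (Some u, Some v) \<in> zip_less P r x y z"
| below: "u \<in> P - {x, y, z} \<Longrightarrow> strictly_below r u x \<or> strictly_below r u y \<Longrightarrow>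
    (Some u, None) \<in> zip_less P r x y z"
| above: "v \<in> P - {x, y, z} \<Longrightarrow> strictly_below r x v \<or> strictly_below r y v \<Longrightarrow>
    (None, Some v) \<in> zip_less P r x y z"
| trans: "(a, b) \<in> zip_less P r x y z \<Longrightarrow> (b, c) \<in> zip_less P r x y z \<Longrightarrow>
    (a, c) \<in> zip_less P r x y z"

definition zip_order :: "'a set \<Rightarrow> 'a rel \<Rightarrow> 'a \<Rightarrow> 'a \<Rightarrow> 'a \<Rightarrow> 'a option rel" where
  "zip_order P r x y z = Id_on (zip_carrier P x y z) \<union> zip_less P r x y z"

fun zip_rank :: "('a \<Rightarrow> nat) \<Rightarrow> 'a \<Rightarrow> 'a option \<Rightarrow> nat" where
  "zip_rank \<rho> x (Some u) = \<rho> u"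
| "zip_rank \<rho> x None = \<rho> x"

(* Elements u and v incomparable in P can become comparable in the zipped poset, by
   transitivity through w; the inherited value on such a pair is \<zeta> u v = 0. *)
fun zip_zeta ::
  "('a \<Rightarrow> 'a \<Rightarrow> complex) \<Rightarrow> 'a \<Rightarrow> 'a \<Rightarrow> 'a \<Rightarrow> 'a option \<Rightarrow> 'a option \<Rightarrow> complex" where
  "zip_zeta \<zeta> x y z (Some u) (Some v) = \<zeta> u v"
| "zip_zeta \<zeta> x y z None (Some v) = \<zeta> x v"
| "zip_zeta \<zeta> x y z (Some u) None = \<zeta> u x + \<zeta> u y - \<zeta> u z"
| "zip_zeta \<zeta> x y z None None = 1"

end

theory Submission
  imports Defs
begin

text \<open>
  Since \<open>\<zeta>\<close> vanishes off the order, the Eulerian condition says that the signed convolution of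
  \<open>\<zeta>\<close> with itself, summed over all of \<open>P\<close>, is \<open>\<delta>\<close>; the intervals of the zipped poset thus play no
  role. In the convolution sum over \<open>P\<close> the terms of \<open>x\<close>, \<open>y\<close> and \<open>z\<close>, of signs \<open>+ + -\<close> relative
  to \<open>\<rho> x\<close>, add up to the term of the new element: in the right factor \<open>\<zeta> x v = \<zeta> y v = \<zeta> z v\<close>
  for every \<open>v \<in> P - {x, y, z}\<close>, and the function \<open>t \<mapsto> \<zeta> t x + \<zeta> t y - \<zeta> t z\<close>, which stands in
  for the column of the new element, takes the value 1 at each of \<open>x\<close>, \<open>y\<close> and \<open>z\<close>.
\<close>

context quasi_graded_poset
begin

lemma order_in_carrier: "(u, v) \<in> r \<Longrightarrow> u \<in> P \<and> v \<in> P"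
  using order by (auto simp: partial_order_on_def preorder_on_def)

lemma order_refl: "u \<in> P \<Longrightarrow> (u, u) \<in> r"
  using order by (auto simp: partial_order_on_def preorder_on_def refl_on_def)

lemma order_trans: "(u, v) \<in> r \<Longrightarrow> (v, w) \<in> r \<Longrightarrow> (u, w) \<in> r"
  using order by (auto simp: partial_order_on_def preorder_on_def dest: transD)

lemma rank_mono: "(u, v) \<in> r \<Longrightarrow> \<rho> u \<le> \<rho> v"
  using rank_strict_mono by (cases "u = v") (auto intro: less_imp_le)

lemma zeta_eq_0_of_rank:
  assumes "u \<in> P" "v \<in> P" "u \<noteq> v" "\<rho> v \<le> \<rho> u"
  shows "\<zeta> u v = 0"
  using assms rank_strict_mono[of u v] zeta_outside by force

text \<open>Terms outside the interval vanish because one of their two factors lies off the order.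
  Inside it, \<open>\<rho> t - \<rho> u\<close> and \<open>\<rho> u + \<rho> t\<close> have the same
  parity; the sum form needs no \<open>u \<le> t\<close>.\<close>

lemma interval_sum_eq:
  assumes "u \<in> P" "v \<in> P"
  shows "(\<Sum>t | (u, t) \<in> r \<and> (t, v) \<in> r. (-1) ^ (\<rho> t - \<rho> u) * \<zeta> u t * \<zeta> t v) =
    (\<Sum>t\<in>P. (-1) ^ (\<rho> u + \<rho> t) * \<zeta> u t * \<zeta> t v)"
proof (rule sum.mono_neutral_cong_left[OF finite_carrier])
  show "{t. (u, t) \<in> r \<and> (t, v) \<in> r} \<subseteq> P"
    using order_in_carrier by auto
  show "\<forall>t\<in>P - {t. (u, t) \<in> r \<and> (t, v) \<in> r}. (-1) ^ (\<rho> u + \<rho> t) * \<zeta> u t * \<zeta> t v = 0"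
    using assms zeta_outside by auto
  fix t assume "t \<in> {t. (u, t) \<in> r \<and> (t, v) \<in> r}"
  then have "\<rho> u \<le> \<rho> t"
    using rank_mono by auto
  then have "(-1 :: complex) ^ (\<rho> t - \<rho> u) = (-1) ^ (\<rho> u + \<rho> t)"
    by (simp add: minus_one_power_iff)
  then show "(-1) ^ (\<rho> t - \<rho> u) * \<zeta> u t * \<zeta> t v = (-1) ^ (\<rho> u + \<rho> t) * \<zeta> u t * \<zeta> t v"
    by simp
qed

lemma eulerian_iff_convolution:
  "eulerian_quasi_graded_poset P r \<rho> \<zeta> \<longleftrightarrow>
    (\<forall>u\<in>P. \<forall>v\<in>P. (\<Sum>t\<in>P. (-1) ^ (\<rho> u + \<rho> t) * \<zeta> u t * \<zeta> t v) = (if u = v then 1 else 0))"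
  (is "_ \<longleftrightarrow> ?R")
proof
  assume "eulerian_quasi_graded_poset P r \<rho> \<zeta>"
  then interpret eulerian_quasi_graded_poset P r \<rho> \<zeta> .
  show ?R
  proof (intro ballI)
    fix u v assume uv: "u \<in> P" "v \<in> P"
    show "(\<Sum>t\<in>P. (-1) ^ (\<rho> u + \<rho> t) * \<zeta> u t * \<zeta> t v) = (if u = v then 1 else 0)"
    proof (cases "(u, v) \<in> r")
      case True
      then show ?thesis
        using eulerian interval_sum_eq[OF uv] by simp
    next
      case False
      \<comment> \<open>By transitivity, incomparability leaves nothing in between, so both sides
        are 0.\<close>
      then have "{t. (u, t) \<in> r \<and> (t, v) \<in> r} = {}" "u \<noteq> v"
        using order_trans order_refl uv by auto
      then show ?thesis
        unfolding interval_sum_eq[OF uv, symmetric] by (simp only: sum.empty if_False)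
    qed
  qed
next
  assume ?R
  then show "eulerian_quasi_graded_poset P r \<rho> \<zeta>"
    using interval_sum_eq order_in_carrier by unfold_locales simp
qed

text \<open>An element of least rank among those strictly above \<open>u\<close> and at most
  \<open>v\<close> covers \<open>u\<close>: anything strictly between would have smaller
  rank.\<close>

lemma covered_below:
  assumes "strictly_below r u v"
  obtains t where "covered_by r u t" "(t, v) \<in> r"
proof -
  let ?S = "\<lambda>t. strictly_below r u t \<and> (t, v) \<in> r"
  have "?S v"
    using assms order_refl order_in_carrier by (auto simp: strictly_below_def)
  then obtain t where t: "?S t" and least: "\<And>s. ?S s \<Longrightarrow> \<rho> t \<le> \<rho> s"
    using ex_has_least_nat[of ?S v \<rho>] by blast
  have "covered_by r u t"
    unfolding covered_by_def
  proof (intro conjI notI)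
    assume "\<exists>s. strictly_below r u s \<and> strictly_below r s t"
    then obtain s where s: "strictly_below r u s" "strictly_below r s t"
      by blast
    then have "?S s"
      using t order_trans by (auto simp: strictly_below_def)
    then show False
      using least[of s] s(2) rank_strict_mono[of s t] by (auto simp: strictly_below_def)
  qed (use t in simp)
  then show ?thesis
    using t that by blast
qed

end

locale zipped_poset = quasi_graded_poset +
  fixes x y z :: 'a
  assumes zipper: "zipper P r \<rho> \<zeta> x y z"
begin

text \<open>The rank equations are oriented so that simplification reduces the ranks of
  \<open>x\<close> and \<open>y\<close> to that of \<open>z\<close>, which makes the three signs
  comparable.\<close>

lemma zipper_props:
  shows "x \<in> P" "y \<in> P" "z \<in> P" "x \<noteq> y" "x \<noteq> z" "y \<noteq> z" "\<rho> y = \<rho> x" "\<rho> x = Suc (\<rho> z)"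
    and "\<zeta> z x = 1" "\<zeta> z y = 1" "covered_by r z v \<longleftrightarrow> v = x \<or> v = y"
  using zipper by (auto simp: zipper_def)

lemma zipper_below: "(z, x) \<in> r" "(z, y) \<in> r"
  using zipper_props(11)[of x] zipper_props(11)[of y]
  by (auto simp: covered_by_def strictly_below_def)

text \<open>Extends zipper condition (iii) to all remaining \<open>v\<close>. If \<open>v\<close> is
  above \<open>z\<close>, it is above one of the only covers \<open>x\<close> and \<open>y\<close>,
  hence of rank greater than \<open>\<rho> x\<close>; otherwise all three values are 0.\<close>

lemma zeta_above_zipper:
  assumes v: "v \<in> P - {x, y, z}"
  shows "\<zeta> y v = \<zeta> x v" "\<zeta> z v = \<zeta> x v"
proof -
  have "\<zeta> y v = \<zeta> x v \<and> \<zeta> z v = \<zeta> x v"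
  proof (cases "(z, v) \<in> r")
    case True
    with v have zv: "strictly_below r z v"
      by (auto simp: strictly_below_def)
    then obtain t where "t = x \<or> t = y" "(t, v) \<in> r"
      using covered_below zipper_props(11) by metis
    then have "\<rho> x < \<rho> v"
      using v rank_strict_mono[of t v] zipper_props(7) by auto
    then show ?thesis
      using zipper zv by (auto simp: zipper_def)
  next
    case False
    then have "(x, v) \<notin> r" "(y, v) \<notin> r"
      using order_trans zipper_below by blast+
    then show ?thesis
      using False v zipper_props zeta_outside by auto
  qed
  then show "\<zeta> y v = \<zeta> x v" "\<zeta> z v = \<zeta> x v"
    by auto
qed

lemma zeta_within_zipper:
  "\<zeta> x x = 1" "\<zeta> y y = 1" "\<zeta> z z = 1" "\<zeta> x y = 0" "\<zeta> y x = 0" "\<zeta> x z = 0" "\<zeta> y z = 0"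
  using zipper_props zeta_diag zeta_eq_0_of_rank by auto

lemma sum_remove_zipper:
  "(\<Sum>t\<in>P. f t) = (\<Sum>t\<in>P - {x, y, z}. f t) + f x + f y + (f z :: complex)"
  using sum.subset_diff[of "{x, y, z}" P f] finite_carrier zipper_props by (simp add: add.assoc)

lemma sum_zip_carrier:
  "(\<Sum>t\<in>zip_carrier P x y z. f t) = (\<Sum>t\<in>P - {x, y, z}. f (Some t)) + (f None :: complex)"
  using finite_carrier unfolding zip_carrier_def
  by (subst sum.insert) (auto simp: sum.reindex add.commute)

lemma zip_less_in_carrier:
  "(a, b) \<in> zip_less P r x y z \<Longrightarrow> a \<in> zip_carrier P x y z \<and> b \<in> zip_carrier P x y z"
  by (induction rule: zip_less.induct) (auto simp: zip_carrier_def)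

text \<open>Besides the rank axiom, this gives antisymmetry: transitive closure through the new
  element creates no cycle.\<close>

lemma zip_less_rank:
  "(a, b) \<in> zip_less P r x y z \<Longrightarrow> zip_rank \<rho> x a < zip_rank \<rho> x b"
proof (induction rule: zip_less.induct)
  case (below u)
  then show ?case
    using rank_strict_mono[of u x] rank_strict_mono[of u y] zipper_props(7) by (auto simp: strictly_below_def)
next
  case (above v)
  then show ?case
    using rank_strict_mono[of x v] rank_strict_mono[of y v] zipper_props(7) by (auto simp: strictly_below_def)
qed (auto simp: strictly_below_def rank_strict_mono)

lemma zip_partial_order: "partial_order_on (zip_carrier P x y z) (zip_order P r x y z)"
proof -
  have "trans (zip_order P r x y z)"
    by (rule transI) (auto simp: zip_order_def intro: zip_less.trans)
  moreover have "antisym (zip_order P r x y z)"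
    by (rule antisymI) (auto simp: zip_order_def dest!: zip_less_rank)
  ultimately show ?thesis
    using zip_less_in_carrier
    by (auto simp: partial_order_on_def preorder_on_def refl_on_def zip_order_def)
qed

lemma zip_zeta_outside:
  assumes a: "a \<in> zip_carrier P x y z" and b: "b \<in> zip_carrier P x y z"
    and ab: "(a, b) \<notin> zip_order P r x y z"
  shows "zip_zeta \<zeta> x y z a b = 0"
proof (cases a; cases b)
  fix u v assume [simp]: "a = Some u" "b = Some v"
  then have uv: "u \<in> P - {x, y, z}" "v \<in> P - {x, y, z}"
    using a b by (auto simp: zip_carrier_def)
  have "(u, v) \<notin> r"
  proof
    assume "(u, v) \<in> r"
    then show False
      using ab a uv zip_less.inherited[OF uv] by (auto simp: zip_order_def strictly_below_def)
  qed
  then show ?thesis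
    using uv zeta_outside by simp
next
  fix u assume [simp]: "a = Some u" "b = None"
  then have u: "u \<in> P - {x, y, z}"
    using a by (auto simp: zip_carrier_def)
  have "(u, x) \<notin> r" "(u, y) \<notin> r"
    using ab u zip_less.below[OF u] by (auto simp: zip_order_def strictly_below_def)
  \<comment> \<open>Below \<open>z\<close> would mean below \<open>x\<close>; hence all three
    summands of the value at the new element vanish.\<close>
  moreover from this have "(u, z) \<notin> r"
    using order_trans zipper_below by blast
  ultimately show ?thesis
    using u zeta_outside zipper_props by simp
next
  fix v assume [simp]: "a = None" "b = Some v"
  then have v: "v \<in> P - {x, y, z}"
    using b by (auto simp: zip_carrier_def)
  have "(x, v) \<notin> r"
    using ab v zip_less.above[OF v] by (auto simp: zip_order_def strictly_below_def)
  then show ?thesis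
    using v zeta_outside zipper_props by simp
next
  assume "a = None" "b = None"
  then show ?thesis
    using a ab by (auto simp: zip_order_def)
qed

lemma zip_quasi_graded_poset:
  "quasi_graded_poset (zip_carrier P x y z) (zip_order P r x y z)
    (zip_rank \<rho> x) (zip_zeta \<zeta> x y z)"
proof
  show "finite (zip_carrier P x y z)"
    using finite_carrier by (simp add: zip_carrier_def)
  show "zip_rank \<rho> x u < zip_rank \<rho> x v"
    if "(u, v) \<in> zip_order P r x y z" "u \<noteq> v" for u v
    using that zip_less_rank by (auto simp: zip_order_def)
  show "zip_zeta \<zeta> x y z u u = 1" if "u \<in> zip_carrier P x y z" for u
    using that zeta_diag by (auto simp: zip_carrier_def)
qed (fact zip_partial_order zip_zeta_outside)+

lemma zip_convolution:
  assumes conv: "\<And>u v. u \<in> P \<Longrightarrow> v \<in> P \<Longrightarrow>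
      (\<Sum>t\<in>P. (-1) ^ (\<rho> u + \<rho> t) * \<zeta> u t * \<zeta> t v) = (if u = v then 1 else 0)"
    and a: "a \<in> zip_carrier P x y z" and b: "b \<in> zip_carrier P x y z"
  shows "(\<Sum>t\<in>zip_carrier P x y z. (-1) ^ (zip_rank \<rho> x a + zip_rank \<rho> x t) *
      zip_zeta \<zeta> x y z a t * zip_zeta \<zeta> x y z t b) = (if a = b then 1 else 0)"
proof (cases a; cases b)
  fix u v assume [simp]: "a = Some u" "b = Some v"
  then have uv: "u \<in> P - {x, y, z}" "v \<in> P - {x, y, z}"
    using a b by (auto simp: zip_carrier_def)
  then show ?thesis
    using conv[of u v] zeta_above_zipper[of v]
    by (simp add: sum_zip_carrier sum_remove_zipper zipper_props(7,8) algebra_simps)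
next
  fix u assume [simp]: "a = Some u" "b = None"
  then have u: "u \<in> P - {x, y, z}"
    using a by (auto simp: zip_carrier_def)
  let ?g = "\<lambda>t. \<zeta> t x + \<zeta> t y - \<zeta> t z"
  \<comment> \<open>By linearity this combines the convolutions at \<open>(u, x)\<close>,
    \<open>(u, y)\<close> and \<open>(u, z)\<close>, each 0 because \<open>u\<close> differs from
    \<open>x\<close>, \<open>y\<close> and \<open>z\<close>.\<close>
  have "(\<Sum>t\<in>P. (-1) ^ (\<rho> u + \<rho> t) * \<zeta> u t * ?g t) = 0"
    using u conv[of u x] conv[of u y] conv[of u z] zipper_props
    by (simp add: algebra_simps sum.distrib sum_subtractf)
  then show ?thesis
    using zipper_props(9,10) zeta_within_zipper
    by (simp add: sum_zip_carrier sum_remove_zipper zipper_props(7,8) algebra_simps)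
next
  fix v assume [simp]: "a = None" "b = Some v"
  then have v: "v \<in> P - {x, y, z}"
    using b by (auto simp: zip_carrier_def)
  then have "v \<in> P" "x \<noteq> v"
    by auto
  \<comment> \<open>In the convolution at \<open>(x, v)\<close> the terms of \<open>y\<close> and
    \<open>z\<close> vanish, since \<open>\<zeta> x y = \<zeta> x z = 0\<close>; the term of
    \<open>x\<close> is that of the new element.\<close>
  then show ?thesis
    using conv[of x v] zeta_within_zipper zipper_props(1)
    by (simp add: sum_zip_carrier sum_remove_zipper power_add[symmetric] mult_2[symmetric])
next
  assume [simp]: "a = None" "b = None"
  \<comment> \<open>A nonzero left factor forces \<open>t\<close> above \<open>x\<close>, so its
    rank exceeds those of \<open>x\<close>, \<open>y\<close> and \<open>z\<close> and the right
    factor is 0. Only the term 1 of the new element survives.\<close>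
  have "\<zeta> x t * (\<zeta> t x + \<zeta> t y - \<zeta> t z) = 0" if t: "t \<in> P - {x, y, z}" for t
  proof (cases "(x, t) \<in> r")
    case True
    then have "\<rho> x < \<rho> t"
      using t rank_strict_mono[of x t] by auto
    then show ?thesis
      using t zipper_props zeta_eq_0_of_rank[of t] by simp
  next
    case False
    then show ?thesis
      using t zipper_props zeta_outside by simp
  qed
  then have "(\<Sum>t\<in>P - {x, y, z}.
      (-1) ^ (\<rho> x + \<rho> t) * (\<zeta> x t * (\<zeta> t x + \<zeta> t y - \<zeta> t z))) = 0"
    by (intro sum.neutral ballI) (simp only: mult_zero_right)
  then show ?thesis
    by (simp add: sum_zip_carrier mult.assoc mult_2[symmetric])
qed

end

theorem theorem5p9:
  fixes P :: "'a set" and r :: "'a rel" and \<rho> :: "'a \<Rightarrow> nat" and \<zeta> :: "'a \<Rightarrow> 'a \<Rightarrow> complex"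
    and x y z :: 'a
  assumes "eulerian_quasi_graded_poset P r \<rho> \<zeta>"
    and "zipper P r \<rho> \<zeta> x y z"
  shows "eulerian_quasi_graded_poset (zip_carrier P x y z) (zip_order P r x y z)
    (zip_rank \<rho> x) (zip_zeta \<zeta> x y z)"
proof -
  interpret eulerian_quasi_graded_poset P r \<rho> \<zeta>
    by fact
  interpret zipped_poset P r \<rho> \<zeta> x y z
    by unfold_locales fact
  interpret Q: quasi_graded_poset "zip_carrier P x y z" "zip_order P r x y z"
    "zip_rank \<rho> x" "zip_zeta \<zeta> x y z"
    by (fact zip_quasi_graded_poset)
  show ?thesis
    using assms(1) zip_convolution eulerian_iff_convolution Q.eulerian_iff_convolution by blast
qed

end
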